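(* Let $u$ be a subsonic weak solution (as defined in the context) in $\Omega\subset\{(x_1,x_2):x_1\ge0\}$, where $\Omega\cap\{x_1=0\}\ne\varnothing$, and assume that for some constant $C$ $$\left|\frac{|\nabla u|^2}{x_1^2}-x_2\right|\le Cx_1\quad\text{locally in }\Omega\cap\{u>0\}.$$ Let $x^\circ=(0,x_2^\circ)\in\Omega\cap\partial\{u>0\}$ with $x_2^\circ>0$ (a non-stagnation axis point), and let $u_r(x):=\frac{u(x^\circ+rx)}{r^2}$. Let $u_0:=\lim_{r\to0^+}u_r$ be the blow-up limit (convergence strong in $W^{1,2}_{w,loc}(\mathbb{R}^2_+)$ and locally uniform in $\mathbb{R}^2_+$). Then: (1) Either $u_0\equiv0$, or $u_0(x_1,x_2)=\alpha x_1^2$, where $\alpha>0$ is a uniquely determined constant. In the case $u_0\not\equiv0$, $$\lim_{r\to0^+}r^{-3}\int_{B_r^+(x^\circ)}x_1\chi_{\{u>0\}}\,dx=\frac23.$$ (2) If $u_0\equiv0$, then $\lim_{r\to0^+}r^{-3}\int_{B_r^+(x^\circ)}x_1\chi_{\{u>0\}}\,dx$ equals either $0$ or $\frac23$.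
   Context: Notation. $x=(x_1,x_2)$; $\mathbb{R}^2_+=\{x_1>0\}$; $B_r(x^\circ)$ is the open disc in $\mathbb{R}^2$; $B_r^+(x^\circ)=B_r(x^\circ)\cap\{x_1>0\}$; $\chi_A$ is the characteristic function of $A$. $L^2_w(U)$ is the space of measurable $v$ with $\int_U\frac1{x_1}|v|^2dx<\infty$; $W^{1,2}_w(U)$ is the space of $v\in L^2_w(U)$ with $\nabla v\in L^2_w(U)$; the subscript $loc$ means on compact subsets. An inequality "locally" holds on each compact subset with a constant depending on it. Equation of state. $g>0$ and $\bar\rho_0>0$ are constants; $p\in C^{1,\alpha}([0,\infty))$, twice differentiable on $(0,\infty)$, with $p'(\rho)>0$ and $2p'(\rho)+\rho p''(\rho)>0$ for $\rho>0$; $h(\rho)=\int_{\bar\rho_0}^{\rho}\frac{p'(s)}{s}ds$; $s_*:=\frac{p'(\bar\rho_0)}{2g}$. For $0\le s<s_*$ let $\rho_{cr}(s)$ be the unique number with $\frac{p'(\rho_{cr}(s))}{2}+h(\rho_{cr}(s))=gs$. For $t\ge0$ let $H(t;s)$ be the unique solution $H>\rho_{cr}(s)$ of $\frac{g\bar\rho_0^2t}{H^2}+h(H)=gs$, whenever it exists; in particular $H(s;s)=\bar\rho_0$. Set $F(t;s)=\int_0^t\frac{d\tau}{H(\tau;s)}$, $\partial_1F=\partial F/\partial t=1/H$, $\partial_2F=\partial F/\partial s$, and $\lambda(s)=\frac{2s}{\bar\rho_0}-F(s;s)$. Free boundary problem: $\operatorname{div}\Big(\frac{\nabla u}{x_1H(|\nabla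 u|^2/x_1^2;x_2)}\Big)=0$ in $\Omega\cap\{u>0\}$, $\frac{|\nabla u|^2}{x_1^2}=x_2$ on $\Omega\cap\partial\{u>0\}$, where $\Omega$ is connected and relatively open in $\{x_1\ge0\}$, contained in $\{x_2<s_*\}$. Subsonic variational solution: $u\in W^{1,2}_{w,loc}(\Omega)$ such that (1) $u\ge0$ in $\Omega$, $u=0$ on $\{x_1=0\}$; (2) $u\in C^0(\Omega)\cap C^2(\Omega\cap\{u>0\})$; (3) for every $x^\circ\in\Omega\cap\{x_1=0\}$, as $x\to x^\circ$ with $x\in\Omega\cap\{u>0\}$, $\frac1{x_1}\partial_{x_2}u\to0$ and $\frac1{x_1}\partial_{x_1}u$ has a limit; (4) there is $\varepsilon_0>0$ such that $H(\frac{|\nabla u|^2}{x_1^2};x_2)-\rho_{cr}(x_2)\ge\varepsilon_0$ locally in $\Omega\cap\{x_2\ge0\}$; (5) $\{u>0\}$, hence the free surface $\partial\{u>0\}$, is contained in $\{x_1\ge0,x_2\ge0\}$ (all integrands involving $H,F,\lambda$ are read as $0$ where $x_2<0$); (6) for every $\phi=(\phi_1,\phi_2)\in C^1_0(\Omega;\mathbb{R}^2)$ with $\phi_1=0$ on $\{x_1=0\}$, writing $t=|\nabla u|^2/x_1^2$, $$0=\int_\Omega x_1[F(t;x_2)+\lambda(x_2)\chi_{\{u>0\}}]\operatorname{div}\phi-2\int_\Omega\partial_1F(t;x_2)\tfrac1{x_1}\nabla u\,D\phi\,\nabla u+\int_\Omega\big(F(t;x_2)-2\partial_1F(t;x_2)t+\lambda(x_2)\chi_{\{u>0\}}\big)\phi_1+\int_\Omega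 x_1\big(\partial_2F(t;x_2)+\lambda'(x_2)\chi_{\{u>0\}}\big)\phi_2 .$$ Subsonic weak solution: a subsonic variational solution for which $\partial\{u>0\}\cap\Omega\cap\{x_1>0\}\cap\{x_2\ne0\}$ is locally a $C^{2,\alpha}$ curve. *)

theory Defs
  imports "HOL-Analysis.Analysis"
begin

section \<open>Equation of state\<close>

text \<open>Since \<open>[0,\<infinity>)\<close> is unbounded, \<open>C\<^sup>1\<^sup>,\<^sup>\<beta>([0,\<infinity>))\<close> is read as Hoelder continuity of the derivative on every
  bounded interval \<open>[0,R]\<close>, with the one-sided derivative at \<open>0\<close>.\<close>

definition C1_holder :: "real \<Rightarrow> (real \<Rightarrow> real) \<Rightarrow> bool" where
  "C1_holder \<beta> p \<longleftrightarrow>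
     (\<exists>p'. (\<forall>r\<ge>0. (p has_real_derivative p' r) (at r within {0..})) \<and>
           (\<forall>R. \<exists>C. \<forall>x\<in>{0..R}. \<forall>y\<in>{0..R}. \<bar>p' x - p' y\<bar> \<le> C * \<bar>x - y\<bar> powr \<beta>))"

definition equation_of_state :: "real \<Rightarrow> real \<Rightarrow> real \<Rightarrow> (real \<Rightarrow> real) \<Rightarrow> bool" where
  "equation_of_state g rho0 \<beta> p \<longleftrightarrow>
     0 < g \<and> 0 < rho0 \<and> 0 < \<beta> \<and> \<beta> < 1 \<and> C1_holder \<beta> p \<and>
     (\<forall>r>0. deriv p differentiable (at r)) \<and>
     (\<forall>r>0. deriv p r > 0) \<and>
     (\<forall>r>0. 2 * deriv p r + r * deriv (deriv p) r > 0)"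

definition enthalpy :: "real \<Rightarrow> (real \<Rightarrow> real) \<Rightarrow> real \<Rightarrow> real" where
  "enthalpy rho0 p r = (LBINT s=rho0..r. deriv p s / s)"

definition s_star :: "real \<Rightarrow> real \<Rightarrow> (real \<Rightarrow> real) \<Rightarrow> real" where
  "s_star g rho0 p = deriv p rho0 / (2 * g)"

definition rho_cr :: "real \<Rightarrow> real \<Rightarrow> (real \<Rightarrow> real) \<Rightarrow> real \<Rightarrow> real" where
  "rho_cr g rho0 p s = (THE r. 0 < r \<and> deriv p r / 2 + enthalpy rho0 p r = g * s)"

definition is_H :: "real \<Rightarrow> real \<Rightarrow> (real \<Rightarrow> real) \<Rightarrow> real \<Rightarrow> real \<Rightarrow> real \<Rightarrow> bool" where
  "is_H g rho0 p t s r \<longleftrightarrow>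
     rho_cr g rho0 p s < r \<and> g * rho0\<^sup>2 * t / r\<^sup>2 + enthalpy rho0 p r = g * s"

definition H_dens :: "real \<Rightarrow> real \<Rightarrow> (real \<Rightarrow> real) \<Rightarrow> real \<Rightarrow> real \<Rightarrow> real" where
  "H_dens g rho0 p t s = (THE r. is_H g rho0 p t s r)"

definition F_int :: "real \<Rightarrow> real \<Rightarrow> (real \<Rightarrow> real) \<Rightarrow> real \<Rightarrow> real \<Rightarrow> real" where
  "F_int g rho0 p t s = (LBINT \<tau>=0..t. 1 / H_dens g rho0 p \<tau> s)"

text \<open>\<open>\<partial>F/\<partial>t\<close> is written as \<open>1/H\<close>, which also gives it its (one-sided) value at \<open>t = 0\<close>.\<close>

definition d1F :: "real \<Rightarrow> real \<Rightarrow> (real \<Rightarrow> real) \<Rightarrow> real \<Rightarrow> real \<Rightarrow> real" where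
  "d1F g rho0 p t s = 1 / H_dens g rho0 p t s"

definition d2F :: "real \<Rightarrow> real \<Rightarrow> (real \<Rightarrow> real) \<Rightarrow> real \<Rightarrow> real \<Rightarrow> real" where
  "d2F g rho0 p t s = deriv (\<lambda>\<sigma>. F_int g rho0 p t \<sigma>) s"

definition lam :: "real \<Rightarrow> real \<Rightarrow> (real \<Rightarrow> real) \<Rightarrow> real \<Rightarrow> real" where
  "lam g rho0 p s = 2 * s / rho0 - F_int g rho0 p s s"

section \<open>Weighted Sobolev spaces\<close>

definition L2w :: "(real^2) set \<Rightarrow> (real^2 \<Rightarrow> 'b::euclidean_space) \<Rightarrow> bool" where
  "L2w U v \<longleftrightarrow> set_borel_measurable lebesgue U v \<and>
     set_integrable lebesgue U (\<lambda>x. (norm (v x))\<^sup>2 / x$1)"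

definition L2w_loc :: "(real^2) set \<Rightarrow> (real^2 \<Rightarrow> 'b::euclidean_space) \<Rightarrow> bool" where
  "L2w_loc U v \<longleftrightarrow> (\<forall>K. compact K \<and> K \<subseteq> U \<longrightarrow> L2w K v)"

definition half_plane :: "(real^2) set" where
  "half_plane = {x. 0 < x$1}"

text \<open>Weak gradients are tested with \<open>C\<^sup>1\<close> functions of compact support in the interior part
  \<open>U \<inter> half_plane\<close> of a relatively open subset \<open>U\<close> of \<open>{x\<^sub>1 \<ge> 0}\<close>; the rest of \<open>U\<close> is a null set.\<close>

definition has_weak_gradient ::
    "(real^2) set \<Rightarrow> (real^2 \<Rightarrow> real) \<Rightarrow> (real^2 \<Rightarrow> real^2) \<Rightarrow> bool" where
  "has_weak_gradient U v G \<longleftrightarrow>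
     (\<forall>\<phi> D\<phi>. (\<forall>x. GDERIV \<phi> x :> D\<phi> x) \<and> continuous_on UNIV D\<phi> \<and>
        compact (closure {x. \<phi> x \<noteq> 0}) \<and> closure {x. \<phi> x \<noteq> 0} \<subseteq> U \<inter> half_plane \<longrightarrow>
        (LINT x:U \<inter> half_plane|lebesgue. v x *\<^sub>R D\<phi> x) =
        - (LINT x:U \<inter> half_plane|lebesgue. \<phi> x *\<^sub>R G x))"

text \<open>\<open>v\<close> lies in \<open>W\<^sup>1\<^sup>,\<^sup>2\<close> with weight \<open>1/x\<^sub>1\<close>, locally in \<open>U\<close>, and \<open>G\<close> is (a version of) its weak gradient.\<close>

definition W12w_loc :: "(real^2) set \<Rightarrow> (real^2 \<Rightarrow> real) \<Rightarrow> (real^2 \<Rightarrow> real^2) \<Rightarrow> bool" where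
  "W12w_loc U v G \<longleftrightarrow> L2w_loc U v \<and> L2w_loc U G \<and> has_weak_gradient U v G"

section \<open>Subsonic solutions\<close>

definition grad :: "(real^2 \<Rightarrow> real) \<Rightarrow> real^2 \<Rightarrow> real^2" where
  "grad u x = (THE D. GDERIV u x :> D)"

definition C2_on :: "(real^2) set \<Rightarrow> (real^2 \<Rightarrow> real) \<Rightarrow> bool" where
  "C2_on U f \<longleftrightarrow>
     (\<exists>(D :: real^2 \<Rightarrow> real^2) (D2 :: real^2 \<Rightarrow> real^2^2).
        (\<forall>x\<in>U. GDERIV f x :> D x) \<and>
        (\<forall>x\<in>U. (D has_derivative (\<lambda>k. D2 x *v k)) (at x)) \<and>
        continuous_on U D2)"

definition flow_domain :: "real \<Rightarrow> real \<Rightarrow> (real \<Rightarrow> real) \<Rightarrow> (real^2) set \<Rightarrow> bool" where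
  "flow_domain g rho0 p \<Omega> \<longleftrightarrow>
     connected \<Omega> \<and> openin (top_of_set {x. 0 \<le> x$1}) \<Omega> \<and> \<Omega> \<subseteq> {x. x$2 < s_star g rho0 p}"

text \<open>Only the values of \<open>u\<close> on \<open>\<Omega>\<close> are meaningful, so \<open>{u > 0}\<close> always means \<open>pos_set \<Omega> u\<close>.\<close>

definition pos_set :: "(real^2) set \<Rightarrow> (real^2 \<Rightarrow> real) \<Rightarrow> (real^2) set" where
  "pos_set \<Omega> u = {x\<in>\<Omega>. 0 < u x}"

text \<open>\<open>\<phi>\<close> is in \<open>C\<^sup>1\<^sub>0(\<Omega>;\<real>\<^sup>2)\<close> with Jacobian matrix \<open>J\<close>. The support may touch the axis, where the
  derivatives are taken within \<open>\<Omega>\<close>.\<close>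

definition C1_test_field ::
    "(real^2) set \<Rightarrow> (real^2 \<Rightarrow> real^2) \<Rightarrow> (real^2 \<Rightarrow> real^2^2) \<Rightarrow> bool" where
  "C1_test_field \<Omega> \<phi> J \<longleftrightarrow>
     (\<forall>x\<in>\<Omega>. (\<phi> has_derivative (\<lambda>k. J x *v k)) (at x within \<Omega>)) \<and> continuous_on \<Omega> J \<and>
     (\<exists>K. compact K \<and> K \<subseteq> \<Omega> \<and> (\<forall>x\<in>\<Omega> - K. \<phi> x = 0))"

text \<open>The integrands are \<open>0\<close> where \<open>x\<^sub>2 < 0\<close>, hence the domain of integration \<open>\<Omega> \<inter> {x\<^sub>2 \<ge> 0}\<close>.
  \<open>Du\<close> is the weak gradient of \<open>u\<close>, and \<open>trace (J x)\<close> is the divergence of \<open>\<phi>\<close>.\<close>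

definition first_variation ::
    "real \<Rightarrow> real \<Rightarrow> (real \<Rightarrow> real) \<Rightarrow> (real^2) set \<Rightarrow> (real^2 \<Rightarrow> real) \<Rightarrow> (real^2 \<Rightarrow> real^2) \<Rightarrow>
     (real^2 \<Rightarrow> real^2) \<Rightarrow> (real^2 \<Rightarrow> real^2^2) \<Rightarrow> real" where
  "first_variation g rho0 p \<Omega> u Du \<phi> J =
     (let D = \<Omega> \<inter> {x. 0 \<le> x$2};
          t = (\<lambda>x. (norm (Du x))\<^sup>2 / (x$1)\<^sup>2);
          chi = (indicator (pos_set \<Omega> u) :: real^2 \<Rightarrow> real)
      in (LINT x:D|lebesgue. x$1 * (F_int g rho0 p (t x) (x$2) + lam g rho0 p (x$2) * chi x) * trace (J x))
       - 2 * (LINT x:D|lebesgue. d1F g rho0 p (t x) (x$2) * (1 / x$1) * (Du x \<bullet> (J x *v Du x)))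
       + (LINT x:D|lebesgue. (F_int g rho0 p (t x) (x$2) - 2 * d1F g rho0 p (t x) (x$2) * t x
                                + lam g rho0 p (x$2) * chi x) * (\<phi> x $ 1))
       + (LINT x:D|lebesgue. x$1 * (d2F g rho0 p (t x) (x$2) + deriv (lam g rho0 p) (x$2) * chi x)
                                * (\<phi> x $ 2)))"

text \<open>The subsonicity bound presupposes that the quantities in it and in the first variation are
  defined: \<open>F(t;s)\<close> involves \<open>H(\<tau>;s)\<close> for all \<open>0 \<le> \<tau> \<le> t\<close>, and \<open>H\<close> is only a partial function.
  It is an almost-everywhere statement because \<open>Du\<close> is a weak gradient.\<close>

definition subsonic ::
    "real \<Rightarrow> real \<Rightarrow> (real \<Rightarrow> real) \<Rightarrow> (real^2) set \<Rightarrow> (real^2 \<Rightarrow> real^2) \<Rightarrow> bool" where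
  "subsonic g rho0 p \<Omega> Du \<longleftrightarrow>
     (\<forall>K. compact K \<and> K \<subseteq> \<Omega> \<inter> {x. 0 \<le> x$2} \<longrightarrow>
        (\<exists>\<epsilon>0>0. AE x in lebesgue. x \<in> K \<longrightarrow>
           (let t = (norm (Du x))\<^sup>2 / (x$1)\<^sup>2 in
              (\<forall>\<tau>\<in>{0..t}. \<exists>r. is_H g rho0 p \<tau> (x$2) r) \<and>
              H_dens g rho0 p t (x$2) - rho_cr g rho0 p (x$2) \<ge> \<epsilon>0)))"

definition subsonic_variational_solution ::
    "real \<Rightarrow> real \<Rightarrow> (real \<Rightarrow> real) \<Rightarrow> (real^2) set \<Rightarrow> (real^2 \<Rightarrow> real) \<Rightarrow> bool" where
  "subsonic_variational_solution g rho0 p \<Omega> u \<longleftrightarrow>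
     flow_domain g rho0 p \<Omega> \<and>
     (\<forall>x\<in>\<Omega>. 0 \<le> u x) \<and> (\<forall>x\<in>\<Omega>. x$1 = 0 \<longrightarrow> u x = 0) \<and>
     continuous_on \<Omega> u \<and> C2_on (pos_set \<Omega> u) u \<and>
     (\<forall>y\<in>\<Omega>. y$1 = 0 \<longrightarrow>
        ((\<lambda>x. 1 / x$1 * grad u x $ 2) \<longlongrightarrow> 0) (at y within pos_set \<Omega> u) \<and>
        (\<exists>l. ((\<lambda>x. 1 / x$1 * grad u x $ 1) \<longlongrightarrow> l) (at y within pos_set \<Omega> u))) \<and>
     pos_set \<Omega> u \<subseteq> {x. 0 \<le> x$1 \<and> 0 \<le> x$2} \<and>
     (\<exists>Du. W12w_loc \<Omega> u Du \<and> subsonic g rho0 p \<Omega> Du \<and>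
        (\<forall>\<phi> J. C1_test_field \<Omega> \<phi> J \<and> (\<forall>x\<in>\<Omega>. x$1 = 0 \<longrightarrow> \<phi> x $ 1 = 0) \<longrightarrow>
           0 = first_variation g rho0 p \<Omega> u Du \<phi> J))"

definition locally_C2_holder_curve :: "real \<Rightarrow> (real^2) set \<Rightarrow> bool" where
  "locally_C2_holder_curve \<beta> S \<longleftrightarrow>
     (\<forall>x\<in>S. \<exists>V c c1 c2 c_inv C.
        open V \<and> x \<in> V \<and> homeomorphism {-1<..<1} (S \<inter> V) c c_inv \<and>
        (\<forall>\<tau>\<in>{-1<..<1::real}. (c has_vector_derivative c1 \<tau>) (at \<tau>) \<and> c1 \<tau> \<noteq> 0 \<and>
           (c1 has_vector_derivative c2 \<tau>) (at \<tau>)) \<and>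
        (\<forall>\<sigma>\<in>{-1<..<1}. \<forall>\<tau>\<in>{-1<..<1}. norm (c2 \<sigma> - c2 \<tau>) \<le> C * \<bar>\<sigma> - \<tau>\<bar> powr \<beta>))"

definition subsonic_weak_solution ::
    "real \<Rightarrow> real \<Rightarrow> real \<Rightarrow> (real \<Rightarrow> real) \<Rightarrow> (real^2) set \<Rightarrow> (real^2 \<Rightarrow> real) \<Rightarrow> bool" where
  "subsonic_weak_solution g rho0 \<beta> p \<Omega> u \<longleftrightarrow>
     subsonic_variational_solution g rho0 p \<Omega> u \<and>
     locally_C2_holder_curve \<beta>
       (frontier (pos_set \<Omega> u) \<inter> \<Omega> \<inter> {x. 0 < x$1} \<inter> {x. x$2 \<noteq> 0})"

text \<open>Here "locally in \<open>\<Omega> \<inter> {u > 0}\<close>" refers to compact subsets of \<open>\<Omega>\<close>: these may reach the axis and the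
  free surface, whereas on compact subsets of the open set \<open>{u > 0}\<close> itself the bound would be void.\<close>

definition gradient_bound :: "(real^2) set \<Rightarrow> (real^2 \<Rightarrow> real) \<Rightarrow> bool" where
  "gradient_bound \<Omega> u \<longleftrightarrow>
     (\<forall>K. compact K \<and> K \<subseteq> \<Omega> \<longrightarrow>
        (\<exists>C. \<forall>x\<in>K \<inter> pos_set \<Omega> u. \<bar>(norm (grad u x))\<^sup>2 / (x$1)\<^sup>2 - x$2\<bar> \<le> C * x$1))"

section \<open>Blow-up at an axis point\<close>

definition blowup :: "(real^2 \<Rightarrow> real) \<Rightarrow> real^2 \<Rightarrow> real \<Rightarrow> real^2 \<Rightarrow> real" where
  "blowup u x0 r x = u (x0 + r *\<^sub>R x) / r\<^sup>2"

text \<open>\<open>u\<^sub>r\<close> is defined on the rescaled domain \<open>{x. x0 + r x \<in> \<Omega>}\<close>, which contains any given compact subset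
  of the half-plane for small \<open>r\<close>. \<open>Dr r\<close> and \<open>D0\<close> are the weak gradients of \<open>u\<^sub>r\<close> and \<open>u\<^sub>0\<close>.\<close>

definition blowup_limit ::
    "(real^2) set \<Rightarrow> (real^2 \<Rightarrow> real) \<Rightarrow> real^2 \<Rightarrow> (real^2 \<Rightarrow> real) \<Rightarrow> bool" where
  "blowup_limit \<Omega> u x0 u0 \<longleftrightarrow>
     (\<exists>Dr D0.
        (\<forall>r>0. W12w_loc {x. x0 + r *\<^sub>R x \<in> \<Omega>} (blowup u x0 r) (Dr r)) \<and>
        W12w_loc half_plane u0 D0 \<and>
        (\<forall>K. compact K \<and> K \<subseteq> half_plane \<longrightarrow>
           ((\<lambda>r. LINT x:K|lebesgue. (blowup u x0 r x - u0 x)\<^sup>2 / x$1) \<longlongrightarrow> 0) (at_right 0) \<and>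
           ((\<lambda>r. LINT x:K|lebesgue. (norm (Dr r x - D0 x))\<^sup>2 / x$1) \<longlongrightarrow> 0) (at_right 0) \<and>
           uniform_limit K (blowup u x0) u0 (at_right 0)))"

definition scaled_volume :: "(real^2) set \<Rightarrow> (real^2 \<Rightarrow> real) \<Rightarrow> real^2 \<Rightarrow> real \<Rightarrow> real" where
  "scaled_volume \<Omega> u x0 r =
     (LINT x:ball x0 r \<inter> half_plane|lebesgue. x$1 * indicator (pos_set \<Omega> u) x) / r ^ 3"

end

theory Submission
  imports Defs
begin

text \<open>Near \<open>x0\<close>, condition (3) and the gradient bound give \<open>\<nabla>u = x\<^sub>1 (l + o(1), o(1))\<close> on \<open>{u > 0}\<close> with
  \<open>l\<^sup>2 = x0$2\<close>. If \<open>l < 0\<close>, then \<open>u\<close> would increase towards the axis, where it vanishes; so \<open>l > 0\<close>.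
  Hence \<open>u\<close> stays positive to the right of a positive point, and the almost vanishing
  \<open>x\<^sub>2\<close>-derivative spreads positivity vertically. As \<open>x0\<close> is a limit of positive points,
  \<open>{u > 0}\<close> exhausts the half-plane in the blow-up and \<open>u\<^sub>r \<rightarrow> (l / 2) x\<^sub>1\<^sup>2\<close>. So \<open>u\<^sub>0\<close> never
  vanishes identically, and the density is the integral of \<open>x\<^sub>1\<close> over the unit half disc.\<close>

section \<open>Comparison with barriers on an interval and along segments\<close>

text \<open>\<open>f\<close> is known to be differentiable only where it is positive, so
  monotonicity of \<open>f - \<phi>\<close> is available only up to a first zero of
  \<open>f\<close>. At such a zero it would still give \<open>f \<ge> \<phi> > 0\<close>; hence
  there is none, and the comparison runs through to \<open>T\<close>.\<close>

lemma barrier_below: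
  fixes f \<phi> f' \<phi>' :: "real \<Rightarrow> real"
  assumes T: "0 \<le> T" and cont: "continuous_on {0..T} f"
    and init: "\<phi> 0 \<le> f 0" and pos: "\<And>t. t \<in> {0..T} \<Longrightarrow> 0 < \<phi> t"
    and d\<phi>: "\<And>t. t \<in> {0..T} \<Longrightarrow> (\<phi> has_real_derivative \<phi>' t) (at t)"
    and df: "\<And>t. t \<in> {0..T} \<Longrightarrow> 0 < f t \<Longrightarrow> (f has_real_derivative f' t) (at t)"
    and le: "\<And>t. t \<in> {0..T} \<Longrightarrow> 0 < f t \<Longrightarrow> \<phi>' t \<le> f' t"
  shows "\<phi> T \<le> f T"
proof -
  have cont\<phi>: "continuous_on {0..T} \<phi>"
    using d\<phi> by (meson DERIV_isCont continuous_at_imp_continuous_on)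
  \<comment> \<open>Positivity is asked on the open interval only, so that this applies at the first
    zero itself.\<close>
  have step: "\<phi> s \<le> f s" if s: "s \<in> {0..T}" and fpos: "\<And>t. 0 < t \<Longrightarrow> t < s \<Longrightarrow> 0 < f t" for s
  proof -
    have "(\<lambda>t. f t - \<phi> t) 0 \<le> (\<lambda>t. f t - \<phi> t) s"
    proof (rule DERIV_nonneg_imp_increasing_open[of 0 s "\<lambda>t. f t - \<phi> t"])
      show "0 \<le> s" using s by simp
      show "continuous_on {0..s} (\<lambda>t. f t - \<phi> t)"
        using s by (intro continuous_on_diff continuous_on_subset[OF cont] continuous_on_subset[OF cont\<phi>]) auto
      fix t assume t: "0 < t" "t < s"
      with s have t': "t \<in> {0..T}" by auto
      have ft: "0 < f t" using fpos t by blast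
      have "((\<lambda>t. f t - \<phi> t) has_real_derivative f' t - \<phi>' t) (at t)"
        by (intro DERIV_diff df d\<phi> t' ft)
      then show "\<exists>y. ((\<lambda>t. f t - \<phi> t) has_real_derivative y) (at t) \<and> 0 \<le> y"
        using le[OF t' ft] by (intro exI[of _ "f' t - \<phi>' t"]) auto
    qed
    then show ?thesis using init by simp
  qed
  have fpos: "0 < f t" if t: "t \<in> {0..T}" for t
  proof (rule ccontr)
    define S where "S = {0..T} \<inter> f -` {..0}"
    assume "\<not> 0 < f t"
    then have "S \<noteq> {}" using t by (auto simp: S_def)
    moreover have "compact S"
      unfolding compact_eq_bounded_closed S_def
      by (intro conjI continuous_closed_preimage[OF cont] bounded_Int) auto
    \<comment> \<open>\<open>m\<close> is the first point at which \<open>f\<close> fails to be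
      positive.\<close>
    ultimately obtain m where m: "m \<in> S" "\<And>t. t \<in> S \<Longrightarrow> m \<le> t"
      using compact_attains_inf[of S] by blast
    then have mT: "m \<in> {0..T}" and fm: "f m \<le> 0" by (auto simp: S_def)
    have "\<phi> m \<le> f m"
    proof (rule step[OF mT])
      fix t assume "0 < t" "t < m"
      then have "t \<notin> S" using m(2) by force
      with \<open>0 < t\<close> \<open>t < m\<close> mT show "0 < f t" by (auto simp: S_def)
    qed
    with pos[OF mT] fm show False by simp
  qed
  show ?thesis by (rule step) (use T fpos in auto)
qed

text \<open>\<open>grad\<close> is a definite description, so uniqueness of the derivative is what
  gives it content.\<close>

lemma has_gradient_grad:
  assumes "C2_on S u" "x \<in> S"
  shows "GDERIV u x :> grad u x"
proof -
  obtain D where D: "GDERIV u x :> D" using assms unfolding C2_on_def by blast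
  have "D' = D" if "GDERIV u x :> D'" for D'
  proof -
    have "(\<lambda>h. h \<bullet> D') = (\<lambda>h. h \<bullet> D)"
      using that D unfolding gderiv_def by (rule has_derivative_unique)
    then show ?thesis by (metis inner_commute vector_eq_rdot)
  qed
  then show ?thesis unfolding grad_def using D by (metis theI)
qed

text \<open>The slope condition concerns only those points of the segment where \<open>u\<close> is
  positive. The segment may therefore a priori meet the axis or the zero set; positivity along it is
  a result, not an assumption.\<close>

lemma barrier_below_along_segment:
  fixes u :: "real^2 \<Rightarrow> real"
  assumes T: "0 \<le> T" and cont: "continuous_on \<Omega> u" and C2: "C2_on (pos_set \<Omega> u) u"
    and seg: "\<And>t. t \<in> {0..T} \<Longrightarrow> q + t *\<^sub>R v \<in> \<Omega>"
    and init: "\<phi> 0 \<le> u q" and pos: "\<And>t. t \<in> {0..T} \<Longrightarrow> 0 < \<phi> t"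
    and d\<phi>: "\<And>t. t \<in> {0..T} \<Longrightarrow> (\<phi> has_real_derivative \<phi>' t) (at t)"
    and le: "\<And>t. t \<in> {0..T} \<Longrightarrow> q + t *\<^sub>R v \<in> pos_set \<Omega> u \<Longrightarrow> \<phi>' t \<le> grad u (q + t *\<^sub>R v) \<bullet> v"
  shows "\<phi> T \<le> u (q + T *\<^sub>R v)"
proof (rule barrier_below[where f = "\<lambda>t. u (q + t *\<^sub>R v)" and f' = "\<lambda>t. grad u (q + t *\<^sub>R v) \<bullet> v", OF T])
  show "continuous_on {0..T} (\<lambda>t. u (q + t *\<^sub>R v))"
    using seg by (intro continuous_on_compose2[OF cont] continuous_intros) auto
  fix t assume t: "t \<in> {0..T}" "0 < u (q + t *\<^sub>R v)"
  then have mem: "q + t *\<^sub>R v \<in> pos_set \<Omega> u" using seg by (simp add: pos_set_def)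
  have "(u has_derivative (\<lambda>h. h \<bullet> grad u (q + t *\<^sub>R v))) (at (q + t *\<^sub>R v))"
    using has_gradient_grad[OF C2 mem] by (simp add: gderiv_def)
  moreover have "((\<lambda>t. q + t *\<^sub>R v) has_derivative (\<lambda>h. h *\<^sub>R v)) (at t)"
    by (auto intro!: derivative_eq_intros)
  ultimately have "((\<lambda>t. u (q + t *\<^sub>R v)) has_derivative (\<lambda>h. (h *\<^sub>R v) \<bullet> grad u (q + t *\<^sub>R v))) (at t)"
    using has_derivative_compose by fast
  then show "((\<lambda>t. u (q + t *\<^sub>R v)) has_real_derivative grad u (q + t *\<^sub>R v) \<bullet> v) (at t)"
    by (simp add: has_field_derivative_def inner_commute mult_commute_abs)
  show "\<phi>' t \<le> grad u (q + t *\<^sub>R v) \<bullet> v" by (rule le[OF t(1) mem])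
qed (use init pos d\<phi> in auto)

section \<open>Boxes with one side on the axis\<close>

text \<open>A box rather than a half disc: it contains the horizontal segment from each of its
  points to the axis, and every path between two of its points made of one horizontal and one
  vertical segment.\<close>

definition axis_box :: "real^2 \<Rightarrow> real \<Rightarrow> (real^2) set" where
  "axis_box x0 \<delta> = {x. 0 \<le> x$1 \<and> x$1 < \<delta> \<and> \<bar>x$2 - x0$2\<bar> < \<delta>}"

lemma axis_box_subset_ball:
  assumes "x0$1 = 0"
  shows "axis_box x0 (d / 2) \<subseteq> ball x0 d"
proof
  fix x assume x: "x \<in> axis_box x0 (d / 2)"
  have "dist x x0 \<le> (\<Sum>i\<in>UNIV. \<bar>(x - x0) $ i\<bar>)"
    unfolding dist_norm by (rule norm_le_l1_cart)
  also have "\<dots> < d" using x assms by (simp add: sum_2 axis_box_def)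
  finally show "x \<in> ball x0 d" by (simp add: dist_commute)
qed

lemma axis_box_exists:
  assumes "openin (top_of_set {x. 0 \<le> x$1}) \<Omega>" "x0 \<in> \<Omega>" "x0$1 = 0"
  obtains \<delta> where "0 < \<delta>" "axis_box x0 \<delta> \<subseteq> \<Omega>"
proof -
  obtain d where "0 < d" "ball x0 d \<inter> {x. 0 \<le> x$1} \<subseteq> \<Omega>"
    using assms(1,2) unfolding openin_contains_ball by blast
  moreover have "axis_box x0 (d / 2) \<subseteq> {x. 0 \<le> x$1}" by (auto simp: axis_box_def)
  ultimately show ?thesis
    using axis_box_subset_ball[OF assms(3)] by (intro that[of "d / 2"]) (simp, blast)
qed

lemma closure_meets_axis_box:
  assumes "x0 \<in> closure S" "S \<subseteq> {x. 0 \<le> x$1}" "x0$1 = 0" "0 < \<eta>"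
  obtains q where "q \<in> S" "q \<in> axis_box x0 \<eta>"
proof -
  obtain q where q: "q \<in> S" "dist q x0 < \<eta>"
    using assms(1,4) unfolding closure_approachable by blast
  have "\<bar>(q - x0) $ i\<bar> < \<eta>" for i
    using component_le_norm_cart[of "q - x0" i] q(2) by (simp add: dist_norm)
  from this[of 1] this[of 2] have "q \<in> axis_box x0 \<eta>"
    using q(1) assms(2,3) by (auto simp: axis_box_def)
  with q(1) show ?thesis by (rule that)
qed

text \<open>A fixed \<open>z\<close> suffices: \<open>u0\<close> is identified pointwise, and the
  volume is treated by dominated convergence.\<close>

lemma eventually_in_axis_box:
  assumes "0 < \<eta>" "z \<in> half_plane" "x0$1 = 0"
  shows "\<forall>\<^sub>F r in at_right 0. x0 + r *\<^sub>R z \<in> axis_box x0 \<eta>"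
proof -
  have "((\<lambda>r. r * z$1) \<longlongrightarrow> 0) (at_right 0)" "((\<lambda>r. \<bar>r * z$2\<bar>) \<longlongrightarrow> 0) (at_right 0)"
    by (auto intro!: tendsto_eq_intros)
  then have "\<forall>\<^sub>F r in at_right 0. r * z$1 < \<eta>" "\<forall>\<^sub>F r in at_right 0. \<bar>r * z$2\<bar> < \<eta>"
    using assms(1) by (auto dest: order_tendstoD)
  with eventually_at_right_less[of "0::real"] show ?thesis
    by eventually_elim (use assms in \<open>auto simp: axis_box_def half_plane_def\<close>)
qed

section \<open>Quadratic bounds for \<open>u\<close> from bounds on its gradient\<close>

text \<open>Walk from \<open>x\<close> horizontally to the axis: with slope at most
  \<open>m * x$1\<close>, a value above the bound could not be used up on the way, and
  \<open>u\<close> would be positive on the axis. Negative \<open>m\<close> is allowed, which later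
  excludes a negative gradient limit.\<close>

lemma axis_box_upper_bound:
  assumes cont: "continuous_on \<Omega> u" and C2: "C2_on (pos_set \<Omega> u) u"
    and axis0: "\<And>x. x \<in> \<Omega> \<Longrightarrow> x$1 = 0 \<Longrightarrow> u x = 0"
    and sub: "axis_box x0 \<delta> \<subseteq> \<Omega>"
    and g1: "\<And>x. x \<in> axis_box x0 \<delta> \<Longrightarrow> x \<in> pos_set \<Omega> u \<Longrightarrow> grad u x $ 1 \<le> m * x$1"
    and x: "x \<in> axis_box x0 \<delta>" and ux: "0 < u x"
  shows "u x \<le> m / 2 * (x$1)\<^sup>2"
proof (rule ccontr)
  assume *: "\<not> u x \<le> m / 2 * (x$1)\<^sup>2"
  define v :: "real^2" where "v = - axis 1 1"
  \<comment> \<open>The value \<open>u x\<close> minus the largest drop that slope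
    \<open>m * s\<close> permits for \<open>s\<close> between \<open>x$1 - t\<close> and
    \<open>x$1\<close>.\<close>
  define \<phi> where "\<phi> = (\<lambda>t. u x - m / 2 * ((x$1)\<^sup>2 - (x$1 - t)\<^sup>2))"
  have v: "v$1 = -1" "v$2 = 0" by (simp_all add: v_def axis_def)
  have x1: "0 \<le> x$1" using x by (simp add: axis_box_def)
  have seg: "x + t *\<^sub>R v \<in> axis_box x0 \<delta>" if "t \<in> {0..x$1}" for t
    using x that by (auto simp: axis_box_def v)
  have "\<phi> (x$1) \<le> u (x + (x$1) *\<^sub>R v)"
  proof (rule barrier_below_along_segment[OF x1 cont C2])
    show "x + t *\<^sub>R v \<in> \<Omega>" if "t \<in> {0..x$1}" for t using seg[OF that] sub by blast
    show "\<phi> 0 \<le> u x" by (simp add: \<phi>_def)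
    show "0 < \<phi> t" if t: "t \<in> {0..x$1}" for t
    proof -
      \<comment> \<open>\<open>w\<close> runs from 0 to the square of \<open>x$1\<close>. The
        barrier is smallest at the axis if \<open>m \<ge> 0\<close>, by the assumption
        \<open>*\<close> still positive there, and at \<open>x\<close> otherwise.\<close>
      define w where "w = (x$1)\<^sup>2 - (x$1 - t)\<^sup>2"
      have w: "0 \<le> w" "w \<le> (x$1)\<^sup>2" using t by (auto simp: w_def intro!: power_mono)
      have "m / 2 * w < u x"
      proof (cases "m \<ge> 0")
        case True
        then have "m / 2 * w \<le> m / 2 * (x$1)\<^sup>2" using w by (intro mult_left_mono) auto
        with * show ?thesis by simp
      next
        case False
        then have "m / 2 * w \<le> 0" using w by (simp add: mult_nonpos_nonneg)
        with ux show ?thesis by simp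
      qed
      then show ?thesis by (simp add: \<phi>_def w_def)
    qed
    show "(\<phi> has_real_derivative (- m * (x$1 - t))) (at t)" for t
      unfolding \<phi>_def by (auto intro!: derivative_eq_intros)
    show "- m * (x$1 - t) \<le> grad u (x + t *\<^sub>R v) \<bullet> v"
      if "t \<in> {0..x$1}" "x + t *\<^sub>R v \<in> pos_set \<Omega> u" for t
      using g1[OF seg[OF that(1)] that(2)] by (simp add: inner_vec_def sum_2 v)
  qed
  moreover have "u (x + (x$1) *\<^sub>R v) = 0"
    using seg[of "x$1"] x1 sub by (intro axis0) (auto simp: v)
  ultimately show False using * by (simp add: \<phi>_def)
qed

text \<open>Integrate from \<open>q\<close> first horizontally, gaining quadratically in \<open>x$1\<close>, then vertically, losing
  at most \<open>\<epsilon> x\<^sub>1\<close> per unit length.\<close>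

lemma axis_box_lower_bound:
  assumes cont: "continuous_on \<Omega> u" and C2: "C2_on (pos_set \<Omega> u) u"
    and sub: "axis_box x0 \<delta> \<subseteq> \<Omega>" and m: "0 \<le> m"
    and g1: "\<And>x. x \<in> axis_box x0 \<delta> \<Longrightarrow> x \<in> pos_set \<Omega> u \<Longrightarrow> m * x$1 \<le> grad u x $ 1"
    and g2: "\<And>x. x \<in> axis_box x0 \<delta> \<Longrightarrow> x \<in> pos_set \<Omega> u \<Longrightarrow> \<bar>grad u x $ 2\<bar> \<le> \<epsilon> * x$1"
    and q: "q \<in> axis_box x0 \<delta>" "q \<in> pos_set \<Omega> u" and x: "x \<in> axis_box x0 \<delta>"
    and qx: "q$1 \<le> x$1" and \<epsilon>: "0 \<le> \<epsilon>"
    and room: "\<epsilon> * x$1 * \<bar>x$2 - q$2\<bar> < m / 2 * ((x$1)\<^sup>2 - (q$1)\<^sup>2)"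
  shows "m / 2 * ((x$1)\<^sup>2 - (q$1)\<^sup>2) - \<epsilon> * x$1 * \<bar>x$2 - q$2\<bar> \<le> u x"
proof -
  define v :: "real^2" where "v = axis 1 1"
  define \<phi> where "\<phi> = (\<lambda>t. u q + m / 2 * ((q$1 + t)\<^sup>2 - (q$1)\<^sup>2))"
  \<comment> \<open>The corner of the path: level with \<open>q\<close>, directly above or below
    \<open>x\<close>.\<close>
  define y where "y = q + (x$1 - q$1) *\<^sub>R v"
  have v: "v$1 = 1" "v$2 = 0" by (simp_all add: v_def axis_def)
  have y: "y$1 = x$1" "y$2 = q$2" by (simp_all add: y_def v)
  have uq: "0 < u q" using q by (simp add: pos_set_def)
  have q1: "0 \<le> q$1" using q by (simp add: axis_box_def)
  have seg: "q + t *\<^sub>R v \<in> axis_box x0 \<delta>" if "t \<in> {0..x$1 - q$1}" for t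
    using x q that by (auto simp: axis_box_def v)
  have "\<phi> (x$1 - q$1) \<le> u y"
    unfolding y_def
  proof (rule barrier_below_along_segment[OF _ cont C2])
    show "0 \<le> x$1 - q$1" using qx by simp
    show "q + t *\<^sub>R v \<in> \<Omega>" if "t \<in> {0..x$1 - q$1}" for t using seg[OF that] sub by blast
    show "\<phi> 0 \<le> u q" by (simp add: \<phi>_def)
    show "0 < \<phi> t" if t: "t \<in> {0..x$1 - q$1}" for t
    proof -
      have "0 \<le> (q$1 + t)\<^sup>2 - (q$1)\<^sup>2" using t q1 by (auto intro!: power_mono)
      then show ?thesis unfolding \<phi>_def using m uq by (intro add_pos_nonneg mult_nonneg_nonneg) auto
    qed
    show "(\<phi> has_real_derivative (m * (q$1 + t))) (at t)" for t
      unfolding \<phi>_def by (auto intro!: derivative_eq_intros)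
    show "m * (q$1 + t) \<le> grad u (q + t *\<^sub>R v) \<bullet> v"
      if "t \<in> {0..x$1 - q$1}" "q + t *\<^sub>R v \<in> pos_set \<Omega> u" for t
      using g1[OF seg[OF that(1)] that(2)] by (simp add: inner_vec_def sum_2 v)
  qed
  \<comment> \<open>The value \<open>u q > 0\<close> served to make the horizontal barrier positive
    from its start; it is dropped from here on.\<close>
  then have uy: "m / 2 * ((x$1)\<^sup>2 - (q$1)\<^sup>2) \<le> u y" using uq by (simp add: \<phi>_def)
  define c where "c = m / 2 * ((x$1)\<^sup>2 - (q$1)\<^sup>2)"
  define d where "d = x$2 - q$2"
  \<comment> \<open>The sign selects the vertical direction from \<open>y\<close> to
    \<open>x\<close>; for \<open>d = 0\<close> the path is constant.\<close>
  define w :: "real^2" where "w = sgn d *\<^sub>R axis 2 1"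
  have w: "w$1 = 0" "w$2 = sgn d" by (simp_all add: w_def axis_def)
  have seg2: "y + t *\<^sub>R w \<in> axis_box x0 \<delta>" if "t \<in> {0..\<bar>d\<bar>}" for t
    using x q that by (auto simp: axis_box_def w y d_def sgn_if abs_if split: if_splits)
  have x1: "0 \<le> \<epsilon> * x$1" using x \<epsilon> by (simp add: axis_box_def)
  have "(\<lambda>t. c - \<epsilon> * x$1 * t) \<bar>d\<bar> \<le> u (y + \<bar>d\<bar> *\<^sub>R w)"
  proof (rule barrier_below_along_segment[OF _ cont C2])
    show "y + t *\<^sub>R w \<in> \<Omega>" if "t \<in> {0..\<bar>d\<bar>}" for t using seg2[OF that] sub by blast
    \<comment> \<open>The barrier does not increase along the path, and \<open>room\<close> is its
      positivity at the far end.\<close>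
    show "0 < c - \<epsilon> * x$1 * t" if t: "t \<in> {0..\<bar>d\<bar>}" for t
    proof -
      have "\<epsilon> * x$1 * t \<le> \<epsilon> * x$1 * \<bar>d\<bar>" using t x1 by (intro mult_left_mono) auto
      then show ?thesis using room by (simp add: c_def d_def)
    qed
    show "((\<lambda>t. c - \<epsilon> * x$1 * t) has_real_derivative (- (\<epsilon> * x$1))) (at t)" for t
      by (auto intro!: derivative_eq_intros)
    show "- (\<epsilon> * x$1) \<le> grad u (y + t *\<^sub>R w) \<bullet> w"
      if "t \<in> {0..\<bar>d\<bar>}" "y + t *\<^sub>R w \<in> pos_set \<Omega> u" for t
      using g2[OF seg2[OF that(1)] that(2)] x1
      by (auto simp: inner_vec_def sum_2 w y sgn_if abs_le_iff)
  qed (use uy in \<open>auto simp: c_def\<close>)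
  moreover have "y + \<bar>d\<bar> *\<^sub>R w = x"
    by (simp add: vec_eq_iff forall_2 w y) (simp add: d_def abs_mult_sgn)
  ultimately show ?thesis by (simp add: c_def d_def)
qed

section \<open>From the gradient at the axis to the blow-up limit\<close>

text \<open>A positive point lies off the axis, where \<open>u\<close> vanishes. So it differs from
  \<open>x0\<close>, as the punctured limits require, and \<open>x$1 > 0\<close> clears the
  denominators.\<close>

lemma gradient_bounds_near_axis:
  assumes sub: "axis_box x0 \<delta> \<subseteq> \<Omega>" "0 < \<delta>" and x0: "x0$1 = 0"
    and axis0: "\<And>x. x \<in> \<Omega> \<Longrightarrow> x$1 = 0 \<Longrightarrow> u x = 0"
    and lim1: "((\<lambda>x. 1 / x$1 * grad u x $ 1) \<longlongrightarrow> l) (at x0 within pos_set \<Omega> u)"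
    and lim2: "((\<lambda>x. 1 / x$1 * grad u x $ 2) \<longlongrightarrow> 0) (at x0 within pos_set \<Omega> u)"
    and \<epsilon>: "0 < \<epsilon>"
  obtains \<eta> where "0 < \<eta>" "\<eta> \<le> \<delta>"
    "\<And>x. x \<in> axis_box x0 \<eta> \<Longrightarrow> x \<in> pos_set \<Omega> u \<Longrightarrow> (l - \<epsilon>) * x$1 \<le> grad u x $ 1"
    "\<And>x. x \<in> axis_box x0 \<eta> \<Longrightarrow> x \<in> pos_set \<Omega> u \<Longrightarrow> grad u x $ 1 \<le> (l + \<epsilon>) * x$1"
    "\<And>x. x \<in> axis_box x0 \<eta> \<Longrightarrow> x \<in> pos_set \<Omega> u \<Longrightarrow> \<bar>grad u x $ 2\<bar> \<le> \<epsilon> * x$1"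
proof -
  have "\<forall>\<^sub>F x in at x0 within pos_set \<Omega> u.
      dist (1 / x$1 * grad u x $ 1) l < \<epsilon> \<and> dist (1 / x$1 * grad u x $ 2) 0 < \<epsilon>"
    using tendstoD[OF lim1 \<epsilon>] tendstoD[OF lim2 \<epsilon>] by (rule eventually_conj)
  then obtain d where d: "0 < d" and *: "\<And>x. x \<in> pos_set \<Omega> u \<Longrightarrow> x \<noteq> x0 \<Longrightarrow> dist x x0 < d \<Longrightarrow>
      dist (1 / x$1 * grad u x $ 1) l < \<epsilon> \<and> dist (1 / x$1 * grad u x $ 2) 0 < \<epsilon>"
    by (auto simp: eventually_at)
  have bounds: "(l - \<epsilon>) * x$1 \<le> grad u x $ 1 \<and> grad u x $ 1 \<le> (l + \<epsilon>) * x$1 \<and>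
      \<bar>grad u x $ 2\<bar> \<le> \<epsilon> * x$1"
    if x: "x \<in> axis_box x0 (min \<delta> (d / 2))" "x \<in> pos_set \<Omega> u" for x
  proof -
    have "x$1 \<noteq> 0" using x(2) axis0[of x] by (auto simp: pos_set_def)
    with x(1) have x1: "0 < x$1" by (auto simp: axis_box_def)
    have "axis_box x0 (min \<delta> (d / 2)) \<subseteq> axis_box x0 (d / 2)" by (auto simp: axis_box_def)
    then have "dist x x0 < d" using axis_box_subset_ball[OF x0, of d] x(1) by (auto simp: dist_commute)
    then have "dist (1 / x$1 * grad u x $ 1) l < \<epsilon> \<and> dist (1 / x$1 * grad u x $ 2) 0 < \<epsilon>"
      using * x(2) x1 x0 by (metis less_irrefl)
    then have "l - \<epsilon> < grad u x $ 1 / x$1" "grad u x $ 1 / x$1 < l + \<epsilon>" "\<bar>grad u x $ 2\<bar> / x$1 < \<epsilon>"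
      using x1 by (auto simp: dist_real_def abs_mult)
    then show ?thesis using x1 by (auto simp: field_simps)
  qed
  show ?thesis
    by (rule that[of "min \<delta> (d / 2)"]) (use bounds d sub in auto)
qed

text \<open>From below, \<open>x0\<close> being a limit of positive points, each \<open>r\<close>
  admits a positive starting point within about \<open>\<epsilon> * r\<close> of \<open>x0\<close>;
  after rescaling its offset is of order \<open>\<epsilon>\<close>, uniformly in \<open>r\<close>.
  From above, integration from the axis with slope \<open>l + \<epsilon>\<close> suffices.\<close>

lemma blowup_tendsto_quadratic:
  assumes cont: "continuous_on \<Omega> u" and C2: "C2_on (pos_set \<Omega> u) u"
    and nonneg: "\<And>x. x \<in> \<Omega> \<Longrightarrow> 0 \<le> u x"
    and axis0: "\<And>x. x \<in> \<Omega> \<Longrightarrow> x$1 = 0 \<Longrightarrow> u x = 0"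
    and sub: "axis_box x0 \<delta> \<subseteq> \<Omega>" "0 < \<delta>" and x0: "x0$1 = 0"
    and half: "\<And>x. x \<in> \<Omega> \<Longrightarrow> 0 \<le> x$1"
    and lim1: "((\<lambda>x. 1 / x$1 * grad u x $ 1) \<longlongrightarrow> l) (at x0 within pos_set \<Omega> u)"
    and lim2: "((\<lambda>x. 1 / x$1 * grad u x $ 2) \<longlongrightarrow> 0) (at x0 within pos_set \<Omega> u)"
    and l: "0 < l" and x0_closure: "x0 \<in> closure (pos_set \<Omega> u)"
    and z: "z \<in> half_plane"
  shows "((\<lambda>r. blowup u x0 r z) \<longlongrightarrow> l / 2 * (z$1)\<^sup>2) (at_right 0)"
proof -
  have z1: "0 < z$1" using z by (simp add: half_plane_def)
  note ev_box = eventually_in_axis_box[OF _ z x0]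
  show ?thesis
  proof (rule order_tendstoI)
    fix c assume c: "c < l / 2 * (z$1)\<^sup>2"
    \<comment> \<open>Exceeding a nonnegative level yields in addition the strict inequality
      \<open>room\<close> of \<open>axis_box_lower_bound\<close>.\<close>
    define c' where "c' = max c 0"
    have c': "c' < l / 2 * (z$1)\<^sup>2" using c l z1 by (simp add: c'_def max_def)
    \<comment> \<open>The rescaled lower bound at \<open>z\<close>, for slopes
      \<open>l - \<epsilon>\<close> and \<open>\<epsilon>\<close> and a start displaced by at most
      \<open>\<epsilon>\<close> in each coordinate. At \<open>\<epsilon> = 0\<close> it is the
      claimed limit.\<close>
    have "((\<lambda>\<epsilon>. (l - \<epsilon>) / 2 * ((z$1)\<^sup>2 - \<epsilon>\<^sup>2) - \<epsilon> * z$1 * (\<bar>z$2\<bar> + \<epsilon>)) \<longlongrightarrow>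
        (l - 0) / 2 * ((z$1)\<^sup>2 - 0\<^sup>2) - 0 * z$1 * (\<bar>z$2\<bar> + 0)) (at_right 0)"
      by (intro tendsto_intros) auto
    then have "\<forall>\<^sub>F \<epsilon> in at_right 0. c' < (l - \<epsilon>) / 2 * ((z$1)\<^sup>2 - \<epsilon>\<^sup>2) - \<epsilon> * z$1 * (\<bar>z$2\<bar> + \<epsilon>)"
      using c' by (intro order_tendstoD) auto
    moreover have "\<forall>\<^sub>F \<epsilon> in at_right 0. \<epsilon> < min l (z$1)"
      using l z1 by (intro order_tendstoD[OF tendsto_ident_at]) auto
    ultimately have "\<forall>\<^sub>F \<epsilon> in at_right 0. 0 < \<epsilon> \<and> \<epsilon> < l \<and> \<epsilon> < z$1 \<and>
        c' < (l - \<epsilon>) / 2 * ((z$1)\<^sup>2 - \<epsilon>\<^sup>2) - \<epsilon> * z$1 * (\<bar>z$2\<bar> + \<epsilon>)"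
      using eventually_at_right_less[of "0::real"] by eventually_elim auto
    then obtain \<epsilon> where \<epsilon>: "0 < \<epsilon>" "\<epsilon> < l" "\<epsilon> < z$1"
      and c'\<epsilon>: "c' < (l - \<epsilon>) / 2 * ((z$1)\<^sup>2 - \<epsilon>\<^sup>2) - \<epsilon> * z$1 * (\<bar>z$2\<bar> + \<epsilon>)"
      using eventually_happens'[of "at_right (0::real)"] by force
    obtain \<eta> where \<eta>: "0 < \<eta>" "\<eta> \<le> \<delta>"
      and g1: "\<And>x. x \<in> axis_box x0 \<eta> \<Longrightarrow> x \<in> pos_set \<Omega> u \<Longrightarrow> (l - \<epsilon>) * x$1 \<le> grad u x $ 1"
      and g2: "\<And>x. x \<in> axis_box x0 \<eta> \<Longrightarrow> x \<in> pos_set \<Omega> u \<Longrightarrow> \<bar>grad u x $ 2\<bar> \<le> \<epsilon> * x$1"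
      using gradient_bounds_near_axis[OF sub x0 axis0 lim1 lim2 \<epsilon>(1)] by metis
    have sub\<eta>: "axis_box x0 \<eta> \<subseteq> \<Omega>" using sub \<eta> by (auto simp: axis_box_def)
    have "c' < blowup u x0 r z" if r: "0 < r" and box: "x0 + r *\<^sub>R z \<in> axis_box x0 \<eta>" for r
    proof -
      \<comment> \<open>The start must be close on the scale \<open>r\<close> and lie in the box
        where the gradient bounds hold.\<close>
      have "0 < min (\<epsilon> * r) \<eta>" using \<epsilon> r \<eta> by simp
      then obtain q where q: "q \<in> pos_set \<Omega> u" and qb: "q \<in> axis_box x0 (min (\<epsilon> * r) \<eta>)"
        using closure_meets_axis_box[OF x0_closure _ x0] half
        by (metis (no_types, lifting) mem_Collect_eq pos_set_def subsetI)
      then have qbox: "q \<in> axis_box x0 \<eta>" and q1: "0 \<le> q$1"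
        and q12: "q$1 < \<epsilon> * r" "\<bar>q$2 - x0$2\<bar> < \<epsilon> * r"
        by (auto simp: axis_box_def)
      have xc: "(x0 + r *\<^sub>R z) $ 1 = r * z$1" "(x0 + r *\<^sub>R z) $ 2 = x0$2 + r * z$2"
        using x0 by simp_all
      have "\<epsilon> * r < z$1 * r" using \<epsilon> r by simp
      then have q_left: "q$1 \<le> (x0 + r *\<^sub>R z) $ 1" using q12 q1 xc by (simp add: mult.commute)
      have "\<bar>x0$2 + r * z$2 - q$2\<bar> \<le> r * \<bar>z$2\<bar> + \<epsilon> * r"
        using q12 r abs_triangle_ineq4[of "r * z$2" "q$2 - x0$2"] by (simp add: abs_mult algebra_simps)
      then have v: "\<epsilon> * (r * z$1) * \<bar>x0$2 + r * z$2 - q$2\<bar> \<le> \<epsilon> * (r * z$1) * (r * \<bar>z$2\<bar> + \<epsilon> * r)"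
        using \<epsilon> r z1 by (intro mult_left_mono) auto
      have "(q$1)\<^sup>2 \<le> (\<epsilon> * r)\<^sup>2" using q12 q1 by (intro power_mono) auto
      then have h: "(l - \<epsilon>) / 2 * ((r * z$1)\<^sup>2 - (\<epsilon> * r)\<^sup>2) \<le> (l - \<epsilon>) / 2 * ((r * z$1)\<^sup>2 - (q$1)\<^sup>2)"
        using \<epsilon> by (intro mult_left_mono) auto
      have "r\<^sup>2 * c' < r\<^sup>2 * ((l - \<epsilon>) / 2 * ((z$1)\<^sup>2 - \<epsilon>\<^sup>2) - \<epsilon> * z$1 * (\<bar>z$2\<bar> + \<epsilon>))"
        using c'\<epsilon> r by simp
      also have "\<dots> = (l - \<epsilon>) / 2 * ((r * z$1)\<^sup>2 - (\<epsilon> * r)\<^sup>2) - \<epsilon> * (r * z$1) * (r * \<bar>z$2\<bar> + \<epsilon> * r)"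
        by (simp add: field_simps power2_eq_square)
      also have "\<dots> \<le> (l - \<epsilon>) / 2 * ((r * z$1)\<^sup>2 - (q$1)\<^sup>2) - \<epsilon> * (r * z$1) * \<bar>x0$2 + r * z$2 - q$2\<bar>"
        using v h by linarith
      finally have lower: "r\<^sup>2 * c' <
          (l - \<epsilon>) / 2 * ((r * z$1)\<^sup>2 - (q$1)\<^sup>2) - \<epsilon> * (r * z$1) * \<bar>x0$2 + r * z$2 - q$2\<bar>" .
      moreover have "0 \<le> r\<^sup>2 * c'" by (simp add: c'_def)
      ultimately have "(l - \<epsilon>) / 2 * ((r * z$1)\<^sup>2 - (q$1)\<^sup>2) - \<epsilon> * (r * z$1) * \<bar>x0$2 + r * z$2 - q$2\<bar>
          \<le> u (x0 + r *\<^sub>R z)"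
        using axis_box_lower_bound[OF cont C2 sub\<eta> _ g1 g2 qbox q box q_left] \<epsilon> unfolding xc by simp
      with lower have "r\<^sup>2 * c' < u (x0 + r *\<^sub>R z)" by linarith
      then show ?thesis using r by (simp add: blowup_def field_simps)
    qed
    then have "\<forall>\<^sub>F r in at_right 0. c' < blowup u x0 r z"
      using eventually_at_right_less[of "0::real"] ev_box[OF \<eta>(1)] by (rule_tac eventually_elim2)
    then show "\<forall>\<^sub>F r in at_right 0. c < blowup u x0 r z"
      by eventually_elim (simp add: c'_def)
  next
    fix c assume c: "l / 2 * (z$1)\<^sup>2 < c"
    \<comment> \<open>With this choice the bound for slope \<open>l + \<epsilon>\<close> is the
      midpoint between the limit and \<open>c\<close>.\<close>
    define \<epsilon> where "\<epsilon> = (c - l / 2 * (z$1)\<^sup>2) / (z$1)\<^sup>2"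
    have \<epsilon>: "0 < \<epsilon>" using c z1 by (simp add: \<epsilon>_def)
    have c\<epsilon>: "(l + \<epsilon>) / 2 * (z$1)\<^sup>2 < c"
    proof -
      have "\<epsilon> * (z$1)\<^sup>2 = c - l / 2 * (z$1)\<^sup>2" using z1 by (simp add: \<epsilon>_def)
      then show ?thesis using c by (simp add: field_simps)
    qed
    obtain \<eta> where \<eta>: "0 < \<eta>" "\<eta> \<le> \<delta>"
      and g1: "\<And>x. x \<in> axis_box x0 \<eta> \<Longrightarrow> x \<in> pos_set \<Omega> u \<Longrightarrow> grad u x $ 1 \<le> (l + \<epsilon>) * x$1"
      using gradient_bounds_near_axis[OF sub x0 axis0 lim1 lim2 \<epsilon>(1)] by metis
    have sub\<eta>: "axis_box x0 \<eta> \<subseteq> \<Omega>" using sub \<eta> by (auto simp: axis_box_def)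
    have "blowup u x0 r z < c" if r: "0 < r" and box: "x0 + r *\<^sub>R z \<in> axis_box x0 \<eta>" for r
    proof -
      have "u (x0 + r *\<^sub>R z) \<le> (l + \<epsilon>) / 2 * (r * z$1)\<^sup>2"
      proof (cases "0 < u (x0 + r *\<^sub>R z)")
        case True
        with axis_box_upper_bound[OF cont C2 axis0 sub\<eta> g1 box] show ?thesis using x0 by simp
      next
        case False
        moreover have "0 \<le> (l + \<epsilon>) / 2 * (r * z$1)\<^sup>2" using l \<epsilon> by simp
        ultimately show ?thesis by linarith
      qed
      also have "\<dots> = r\<^sup>2 * ((l + \<epsilon>) / 2 * (z$1)\<^sup>2)" by (simp add: power_mult_distrib)
      also have "\<dots> < r\<^sup>2 * c" using c\<epsilon> r by (intro mult_strict_left_mono) auto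
      finally show ?thesis using r by (simp add: blowup_def field_simps)
    qed
    then show "\<forall>\<^sub>F r in at_right 0. blowup u x0 r z < c"
      using eventually_at_right_less[of "0::real"] ev_box[OF \<eta>(1)] by (rule_tac eventually_elim2)
  qed
qed

section \<open>The integral of \<open>x$1\<close> over the unit half disc\<close>

lemma prod_Basis_vec2: "(\<Prod>b\<in>(Basis :: (real^2) set). f b) = f (axis 1 1) * f (axis 2 1)"
proof -
  have *: "(Basis :: (real^2) set) = {axis 1 1, axis 2 1}"
    by (auto simp: Basis_vec_def) (metis exhaust_2)
  have "axis 1 1 \<noteq> (axis 2 1 :: real^2)" by (simp add: axis_eq_axis)
  then show ?thesis unfolding * by simp
qed

lemma measurable_vec2 [measurable]:
  "(\<lambda>z::real \<times> real. vector [snd z, fst z] :: real^2) \<in> borel_measurable borel"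
proof -
  have "(\<lambda>z::real \<times> real. vector [snd z, fst z] :: real^2) = (\<lambda>z. snd z *\<^sub>R axis 1 1 + fst z *\<^sub>R axis 2 1)"
    by (auto simp: fun_eq_iff vec_eq_iff forall_2 axis_def)
  then show ?thesis
    by (simp add: borel_measurable_continuous_onI continuous_intros)
qed

text \<open>Agreement on boxes determines the measure, and Tonelli becomes available on
  \<open>real^2\<close>. The coordinates are swapped so that the inner integral runs over
  \<open>x$1\<close>.\<close>

lemma lborel_vec2:
  "(lborel :: (real^2) measure) = distr lborel borel (\<lambda>z. vector [snd z, fst z])"
proof (rule lborel_eqI)
  fix l u :: "real^2"
  assume le: "\<And>b. b \<in> Basis \<Longrightarrow> l \<bullet> b \<le> u \<bullet> b"
  have le': "l$1 \<le> u$1" "l$2 \<le> u$2"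
    using le[of "axis 1 1"] le[of "axis 2 1"] by (auto simp: inner_axis axis_in_Basis_iff)
  have "(\<lambda>z. vector [snd z, fst z]) -` box l u = {l$2<..<u$2} \<times> {l$1<..<u$1}"
    by (auto simp: mem_box_cart forall_2)
  then have "emeasure (distr lborel borel (\<lambda>z. vector [snd z, fst z])) (box l u)
      = emeasure (lborel \<Otimes>\<^sub>M lborel) ({l$2<..<u$2} \<times> {l$1<..<u$1})"
    by (subst emeasure_distr) (simp_all add: lborel_prod)
  also have "\<dots> = ennreal (u$2 - l$2) * ennreal (u$1 - l$1)"
    using le' by (simp add: lborel.emeasure_pair_measure_Times)
  also have "\<dots> = ennreal (\<Prod>b\<in>Basis. (u - l) \<bullet> b)"
    using le' by (simp add: prod_Basis_vec2 inner_axis ennreal_mult mult.commute)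
  finally show "emeasure (distr lborel borel (\<lambda>z. vector [snd z, fst z])) (box l u) =
      ennreal (\<Prod>b\<in>Basis. (u - l) \<bullet> b)" .
qed simp

lemma half_plane_borel [measurable]: "half_plane \<in> sets borel"
  unfolding half_plane_def by (intro borel_open open_Collect_less continuous_intros)

lemma mem_half_disc: "x \<in> ball 0 1 \<inter> half_plane \<longleftrightarrow> 0 < x$1 \<and> (x$1)\<^sup>2 + (x$2)\<^sup>2 < 1"
proof -
  have "norm x < 1 \<longleftrightarrow> (x$1)\<^sup>2 + (x$2)\<^sup>2 < 1"
    by (simp add: norm_eq_sqrt_inner inner_vec_def sum_2 power2_eq_square)
  then show ?thesis by (auto simp: half_plane_def)
qed

lemma measurable_component [measurable]: "(\<lambda>x::real^2. x$i) \<in> borel_measurable borel"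
  by (intro borel_measurable_continuous_onI continuous_intros)

text \<open>The slice at height \<open>y\<close> is the interval from 0 to
  \<open>sqrt (1 - y\<^sup>2)\<close>, with moment \<open>(1 - y\<^sup>2) / 2\<close>; this is then
  integrated over \<open>{-1..1}\<close>.\<close>

lemma half_disc_moment:
  "(LINT x:ball 0 1 \<inter> half_plane|lborel. (x::real^2)$1) = 2/3"
proof -
  define D :: "(real^2) set" where "D = ball 0 1 \<inter> half_plane"
  have [measurable]: "D \<in> sets borel" by (simp add: D_def)
  have inner_int: "(\<integral>\<^sup>+x. ennreal (indicator D (vector [x, y] :: real^2) * x) \<partial>lborel)
      = ennreal ((1 - y\<^sup>2) / 2) * indicator {-1..1} y" for y :: real
  proof (cases "y \<in> {-1..1}")
    case True
    define s where "s = sqrt (1 - y\<^sup>2)"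
    have y2: "y\<^sup>2 \<le> 1" using True by (auto simp: abs_square_le_1)
    then have s: "0 \<le> s" "s\<^sup>2 = 1 - y\<^sup>2" by (auto simp: s_def)
    have mem: "(vector [x, y] :: real^2) \<in> D \<longleftrightarrow> 0 < x \<and> x < s" for x
    proof -
      have "x\<^sup>2 + y\<^sup>2 < 1 \<longleftrightarrow> x < s" if "0 < x"
        using that s power_strict_mono[of x s 2] power_mono[of s x 2] by (smt (verit) zero_less_numeral)
      then show ?thesis unfolding D_def mem_half_disc by auto
    qed
    \<comment> \<open>The slice is open, the fundamental theorem takes a closed interval. At 0 the
      integrand vanishes, and \<open>s\<close> is a null set.\<close>
    have "(\<integral>\<^sup>+x. ennreal (indicator D (vector [x, y] :: real^2) * x) \<partial>lborel)
        = (\<integral>\<^sup>+x. ennreal x * indicator {0..s} x \<partial>lborel)"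
    proof (rule nn_integral_cong_AE, use AE_lborel_singleton[of s] in eventually_elim)
      fix x assume "x \<noteq> s"
      then show "ennreal (indicator D (vector [x, y] :: real^2) * x) = ennreal x * indicator {0..s} x"
        by (cases "x = 0") (auto simp: indicator_def mem)
    qed
    also have "\<dots> = ennreal (s\<^sup>2 / 2 - 0\<^sup>2 / 2)"
      by (rule nn_integral_FTC_Icc) (use s in \<open>auto intro!: derivative_eq_intros\<close>)
    finally show ?thesis using True s by simp
  next
    case False
    then have "1 < y\<^sup>2" by (auto simp: abs_square_less_1 not_le power2_eq_1_iff abs_square_le_1 simp flip: not_le)
    then have "(vector [x, y] :: real^2) \<notin> D" for x
      unfolding D_def mem_half_disc by (smt (verit) vector_2 zero_le_power2)
    then show ?thesis using False by simp
  qed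
  have "(\<lambda>x. ennreal (indicator D x * x$1)) \<in> borel_measurable borel" by measurable
  from measurable_compose[OF measurable_vec2 this]
  have [measurable]: "(\<lambda>z. ennreal (indicator D (vector [snd z, fst z] :: real^2) * snd z))
      \<in> borel_measurable borel" by simp
  have "(\<integral>\<^sup>+x. ennreal (indicator D x * x$1) \<partial>lborel)
      = (\<integral>\<^sup>+z. ennreal (indicator D (vector [snd z, fst z] :: real^2) * snd z) \<partial>(lborel \<Otimes>\<^sub>M lborel))"
    by (subst lborel_vec2, subst nn_integral_distr) (auto simp: lborel_prod)
  also have "\<dots> = (\<integral>\<^sup>+y. \<integral>\<^sup>+x. ennreal (indicator D (vector [x, y] :: real^2) * x) \<partial>lborel \<partial>lborel)"
    by (subst lborel.nn_integral_fst[symmetric]) (auto simp: lborel_prod)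
  also have "\<dots> = (\<integral>\<^sup>+y. ennreal ((1 - y\<^sup>2) / 2) * indicator {-1..1} y \<partial>lborel)"
    by (simp add: inner_int)
  also have "\<dots> = ennreal ((1 / 2 - 1 ^ 3 / 6) - ((-1) / 2 - (-1) ^ 3 / 6))"
    by (rule nn_integral_FTC_Icc[where F = "\<lambda>y. y / 2 - y ^ 3 / 6"])
       (auto intro!: derivative_eq_intros simp: field_simps abs_square_le_1)
  finally have nn: "(\<integral>\<^sup>+x. ennreal (indicator D x * x$1) \<partial>lborel) = ennreal (2 / 3)" by simp
  have "(LINT x|lborel. indicator D x * x$1) = enn2real (\<integral>\<^sup>+x. ennreal (indicator D x * x$1) \<partial>lborel)"
  proof (rule integral_eq_nn_integral)
    show "AE x in lborel. 0 \<le> indicator D x * x$1"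
      by (auto simp: D_def half_plane_def split: split_indicator)
  qed measurable
  also have "\<dots> = 2 / 3" unfolding nn by simp
  finally show ?thesis unfolding set_lebesgue_integral_def D_def real_scaleR_def .
qed

section \<open>The density of the positive set at an axis point\<close>

text \<open>The affine substitution contributes \<open>r\<^sup>2\<close>, and the weight one more
  factor \<open>r\<close> because \<open>x0\<close> lies on the axis; together they cancel the
  normalisation.\<close>

lemma scaled_volume_rescale:
  assumes x0: "x0$1 = 0" and P [measurable]: "pos_set \<Omega> u \<in> sets borel" and r: "0 < r"
  shows "scaled_volume \<Omega> u x0 r =
    (LINT x:ball 0 1 \<inter> half_plane|lborel. x$1 * indicator (pos_set \<Omega> u) (x0 + r *\<^sub>R x))"
proof -
  define f where "f = (\<lambda>x::real^2. indicator (ball x0 r \<inter> half_plane) x * (x$1 * indicator (pos_set \<Omega> u) x))"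
  have f [measurable]: "f \<in> borel_measurable borel"
    unfolding f_def by (intro borel_measurable_times borel_measurable_indicator) auto
  have f_affine: "f (x0 + r *\<^sub>R x) =
      r * (indicator (ball 0 1 \<inter> half_plane) x * (x$1 * indicator (pos_set \<Omega> u) (x0 + r *\<^sub>R x)))" for x
  proof -
    have "x0 + r *\<^sub>R x \<in> ball x0 r \<inter> half_plane \<longleftrightarrow> x \<in> ball 0 1 \<inter> half_plane"
      using r x0 by (auto simp: dist_norm half_plane_def zero_less_mult_iff)
    then show ?thesis using x0 by (simp add: f_def indicator_def)
  qed
  \<comment> \<open>\<open>f\<close> is Borel, so passing to the completion does not change its
    integral.\<close>
  have "(LINT x|lebesgue. f x) = (LINT x|lborel. f x)"
    by (rule integral_completion) simp
  also have "\<dots> = (LINT x|density (distr lborel borel (\<lambda>x. x0 + r *\<^sub>R x)) (\<lambda>_. \<bar>r\<bar> ^ DIM(real^2)). f x)"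
    using lborel_affine[of r x0] r by simp
  also have "\<dots> = r\<^sup>2 * (LINT x|lborel. f (x0 + r *\<^sub>R x))"
    by (subst integral_density) (auto simp: integral_distr)
  also have "\<dots> = r ^ 3 *
      (LINT x:ball 0 1 \<inter> half_plane|lborel. x$1 * indicator (pos_set \<Omega> u) (x0 + r *\<^sub>R x))"
    by (simp add: f_affine set_lebesgue_integral_def power2_eq_square power3_eq_cube)
  finally show ?thesis
    using r by (simp add: scaled_volume_def set_lebesgue_integral_def f_def)
qed

text \<open>Dominated convergence: each point of the half disc eventually belongs to the rescaled
  positive set, and \<open>x$1 < 1\<close> makes the indicator of the half disc a majorant.\<close>

lemma scaled_volume_tendsto:
  assumes x0: "x0$1 = 0" and P [measurable]: "pos_set \<Omega> u \<in> sets borel"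
    and ev: "\<And>z. z \<in> half_plane \<Longrightarrow> \<forall>\<^sub>F r in at_right 0. x0 + r *\<^sub>R z \<in> pos_set \<Omega> u"
  shows "(scaled_volume \<Omega> u x0 \<longlongrightarrow> 2/3) (at_right 0)"
proof -
  define D :: "(real^2) set" where "D = ball 0 1 \<inter> half_plane"
  have [measurable]: "D \<in> sets borel" by (simp add: D_def)
  define F where "F = (\<lambda>r x. indicator D x * (x$1 * indicator (pos_set \<Omega> u) (x0 + r *\<^sub>R x)) :: real)"
  \<comment> \<open>Written in \<open>t = 1 / r\<close>, since the convergence theorem applied here
    is for \<open>at_top\<close>.\<close>
  have "((\<lambda>t. LINT x|lborel. F (inverse t) x) \<longlongrightarrow> (LINT x|lborel. indicator D x * x$1)) at_top"
  proof (rule integral_dominated_convergence_at_top[where w = "indicator D"])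
    show "F (inverse t) \<in> borel_measurable lborel" for t unfolding F_def by measurable
    show "(\<lambda>x. indicator D x * x$1) \<in> borel_measurable lborel" by measurable
    show "integrable lborel (indicator D :: real^2 \<Rightarrow> real)"
      unfolding D_def
      using emeasure_bounded_finite[of "ball 0 1 \<inter> half_plane"]
      by (intro integrable_real_indicator) (auto simp: bounded_Int)
    show "AE x in lborel. ((\<lambda>t. F (inverse t) x) \<longlongrightarrow> indicator D x * x$1) at_top"
    proof (rule AE_I2)
      fix x :: "real^2"
      show "((\<lambda>t. F (inverse t) x) \<longlongrightarrow> indicator D x * x$1) at_top"
      proof (cases "x \<in> D")
        case True
        then have "\<forall>\<^sub>F r in at_right 0. x0 + r *\<^sub>R x \<in> pos_set \<Omega> u"
          by (intro ev) (simp add: D_def)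
        then have "\<forall>\<^sub>F r in at_right 0. F r x = indicator D x * x$1"
          by eventually_elim (simp add: F_def)
        then show ?thesis
          by (intro tendsto_eventually) (simp add: eventually_at_right_to_top)
      qed (simp add: F_def)
    qed
    have "norm (F r x) \<le> indicator D x" for r x
      using component_le_norm_cart[of x 1]
      by (auto simp: F_def D_def half_plane_def split: split_indicator)
    then show "\<forall>\<^sub>F t in at_top. AE x in lborel. norm (F (inverse t) x) \<le> indicator D x"
      by simp
  qed
  moreover have "(LINT x|lborel. indicator D x * x$1) = 2/3"
    using half_disc_moment unfolding set_lebesgue_integral_def D_def real_scaleR_def .
  ultimately have "((\<lambda>r. LINT x|lborel. F r x) \<longlongrightarrow> 2/3) (at_right 0)"
    unfolding filterlim_at_right_to_top by metis
  moreover have "\<forall>\<^sub>F r in at_right 0. (LINT x|lborel. F r x) = scaled_volume \<Omega> u x0 r"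
    using eventually_at_right_less[of "0::real"]
    by eventually_elim (simp add: scaled_volume_rescale[OF x0 P] F_def D_def set_lebesgue_integral_def)
  ultimately show ?thesis by (rule Lim_transform_eventually)
qed

section \<open>Openness of the positive set; size and sign of the gradient limit\<close>

text \<open>Since \<open>u\<close> vanishes on the axis, the positive set stays in the open
  half-plane, where relatively open means open. This makes it Borel.\<close>

lemma open_pos_set:
  assumes op: "openin (top_of_set {x. 0 \<le> x$1}) \<Omega>" and cont: "continuous_on \<Omega> u"
    and axis0: "\<And>x. x \<in> \<Omega> \<Longrightarrow> x$1 = 0 \<Longrightarrow> u x = 0"
  shows "open (pos_set \<Omega> u)"
proof -
  obtain T where T: "open T" "\<Omega> = {x. 0 \<le> x$1} \<inter> T"
    using op by (auto simp: openin_open)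
  have "open half_plane"
    unfolding half_plane_def by (intro open_Collect_less continuous_intros)
  then have "open (T \<inter> half_plane)" using T by blast
  moreover have "continuous_on (T \<inter> half_plane) u"
    using T by (intro continuous_on_subset[OF cont]) (auto simp: half_plane_def)
  ultimately have "open ((T \<inter> half_plane) \<inter> u -` {0<..})"
    by (intro continuous_open_preimage) auto
  moreover have "pos_set \<Omega> u = (T \<inter> half_plane) \<inter> u -` {0<..}"
    using T axis0 by (force simp: pos_set_def half_plane_def)
  ultimately show ?thesis by simp
qed

text \<open>The squared speed is the sum of the squares of the two quotients, so it tends to
  \<open>l\<^sup>2\<close>. The gradient bound forces the same quantity towards \<open>x$2\<close>,
  with an error that vanishes at the axis.\<close>

lemma axis_gradient_limit_square:
  assumes op: "openin (top_of_set {x. 0 \<le> x$1}) \<Omega>" and x0: "x0 \<in> \<Omega>" "x0$1 = 0"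
    and gb: "gradient_bound \<Omega> u" and nontriv: "at x0 within pos_set \<Omega> u \<noteq> bot"
    and lim1: "((\<lambda>x. 1 / x$1 * grad u x $ 1) \<longlongrightarrow> l) (at x0 within pos_set \<Omega> u)"
    and lim2: "((\<lambda>x. 1 / x$1 * grad u x $ 2) \<longlongrightarrow> 0) (at x0 within pos_set \<Omega> u)"
  shows "l\<^sup>2 = x0$2"
proof -
  define t where "t = (\<lambda>x. (norm (grad u x))\<^sup>2 / (x$1)\<^sup>2)"
  have half: "0 \<le> x$1" if "x \<in> \<Omega>" for x
    using op that openin_imp_subset by blast
  have t_eq: "t x = (1 / x$1 * grad u x $ 1)\<^sup>2 + (1 / x$1 * grad u x $ 2)\<^sup>2" for x
    by (simp add: t_def power2_norm_eq_inner inner_vec_def sum_2 power_divide add_divide_distrib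
          flip: power2_eq_square)
  have "(t \<longlongrightarrow> l\<^sup>2 + 0\<^sup>2) (at x0 within pos_set \<Omega> u)"
    unfolding t_eq by (intro tendsto_intros lim1 lim2)
  moreover have "(t \<longlongrightarrow> x0$2) (at x0 within pos_set \<Omega> u)"
  proof -
    \<comment> \<open>The closed half disc is a compact part of \<open>\<Omega>\<close> that reaches
      the axis, so one constant \<open>C\<close> serves up to \<open>x0\<close>.\<close>
    obtain d where d: "0 < d" "cball x0 d \<inter> {x. 0 \<le> x$1} \<subseteq> \<Omega>"
      using op x0 unfolding openin_contains_cball by blast
    have "closed {x::real^2. 0 \<le> x$1}" by (intro closed_Collect_le continuous_intros)
    then have "compact (cball x0 d \<inter> {x. 0 \<le> x$1})" by (intro compact_Int_closed) auto
    with gb d(2) have "\<exists>C. \<forall>x\<in>(cball x0 d \<inter> {x. 0 \<le> x$1}) \<inter> pos_set \<Omega> u. \<bar>t x - x$2\<bar> \<le> C * x$1"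
      unfolding gradient_bound_def t_def by (elim allE[of _ "cball x0 d \<inter> {x. 0 \<le> x$1}"]) simp
    then obtain C where
      C: "\<forall>x\<in>(cball x0 d \<inter> {x. 0 \<le> x$1}) \<inter> pos_set \<Omega> u. \<bar>t x - x$2\<bar> \<le> C * x$1" ..
    have "((\<lambda>x. t x - x$2) \<longlongrightarrow> 0) (at x0 within pos_set \<Omega> u)"
    proof (rule Lim_null_comparison)
      have "\<forall>\<^sub>F x in at x0 within pos_set \<Omega> u. dist x x0 < d"
        using d(1) by (auto simp: eventually_at)
      moreover have "\<forall>\<^sub>F x in at x0 within pos_set \<Omega> u. x \<in> pos_set \<Omega> u"
        by (simp add: eventually_at_filter)
      ultimately show "\<forall>\<^sub>F x in at x0 within pos_set \<Omega> u. norm (t x - x$2) \<le> C * x$1"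
        by eventually_elim (use C half in \<open>auto simp: pos_set_def dist_commute\<close>)
      have "((\<lambda>x. C * x$1) \<longlongrightarrow> C * x0$1) (at x0 within pos_set \<Omega> u)"
        by (intro tendsto_intros)
      then show "((\<lambda>x. C * x$1) \<longlongrightarrow> 0) (at x0 within pos_set \<Omega> u)" using x0 by simp
    qed
    then have "((\<lambda>x. (t x - x$2) + x$2) \<longlongrightarrow> 0 + x0$2) (at x0 within pos_set \<Omega> u)"
      by (intro tendsto_intros)
    then show ?thesis by simp
  qed
  ultimately show ?thesis using tendsto_unique[OF nontriv] by fastforce
qed

text \<open>For negative \<open>l\<close> the upper bound has a negative coefficient, contradicting
  any positive point close to \<open>x0\<close>.\<close>

lemma axis_gradient_limit_nonneg:
  assumes cont: "continuous_on \<Omega> u" and C2: "C2_on (pos_set \<Omega> u) u"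
    and axis0: "\<And>x. x \<in> \<Omega> \<Longrightarrow> x$1 = 0 \<Longrightarrow> u x = 0"
    and sub: "axis_box x0 \<delta> \<subseteq> \<Omega>" "0 < \<delta>" and x0: "x0$1 = 0"
    and half: "\<And>x. x \<in> \<Omega> \<Longrightarrow> 0 \<le> x$1"
    and lim1: "((\<lambda>x. 1 / x$1 * grad u x $ 1) \<longlongrightarrow> l) (at x0 within pos_set \<Omega> u)"
    and lim2: "((\<lambda>x. 1 / x$1 * grad u x $ 2) \<longlongrightarrow> 0) (at x0 within pos_set \<Omega> u)"
    and x0_closure: "x0 \<in> closure (pos_set \<Omega> u)"
  shows "0 \<le> l"
proof (rule ccontr)
  assume "\<not> 0 \<le> l"
  \<comment> \<open>This tolerance leaves the slope \<open>l / 2\<close>, still negative.\<close>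
  then have \<epsilon>: "0 < - l / 2" by simp
  obtain \<eta> where \<eta>: "0 < \<eta>" "\<eta> \<le> \<delta>"
    and g1: "\<And>x. x \<in> axis_box x0 \<eta> \<Longrightarrow> x \<in> pos_set \<Omega> u \<Longrightarrow> grad u x $ 1 \<le> (l + - l / 2) * x$1"
    using gradient_bounds_near_axis[OF sub x0 axis0 lim1 lim2 \<epsilon>] by metis
  have sub\<eta>: "axis_box x0 \<eta> \<subseteq> \<Omega>" using sub \<eta> by (auto simp: axis_box_def)
  have "pos_set \<Omega> u \<subseteq> {x. 0 \<le> x$1}" using half by (auto simp: pos_set_def)
  then obtain q where q: "q \<in> pos_set \<Omega> u" "q \<in> axis_box x0 \<eta>"
    using closure_meets_axis_box[OF x0_closure _ x0 \<eta>(1)] by metis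
  then have uq: "0 < u q" by (simp add: pos_set_def)
  have "u q \<le> (l + - l / 2) / 2 * (q$1)\<^sup>2"
    by (rule axis_box_upper_bound[OF cont C2 axis0 sub\<eta> g1 q(2) uq])
  also have "\<dots> \<le> 0" using \<epsilon> by (intro mult_nonpos_nonneg) auto
  finally show False using uq by simp
qed

section \<open>Identification of the blow-up limit and of the density\<close>

theorem theorem2p3:
  fixes g rho0 \<beta> :: real and p :: "real \<Rightarrow> real" and x0 :: "real^2"
  assumes "equation_of_state g rho0 \<beta> p"
    and "x0$1 = 0" and "x0$2 > 0"
  shows "\<exists>\<alpha>>0. \<forall>(\<Omega> :: (real^2) set) (u :: real^2 \<Rightarrow> real) (u0 :: real^2 \<Rightarrow> real).
    subsonic_weak_solution g rho0 \<beta> p \<Omega> u \<and>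
    \<Omega> \<inter> {x. x$1 = 0} \<noteq> {} \<and>
    gradient_bound \<Omega> u \<and>
    x0 \<in> \<Omega> \<inter> frontier (pos_set \<Omega> u) \<and>
    blowup_limit \<Omega> u x0 u0 \<longrightarrow>
      ((\<forall>x\<in>half_plane. u0 x = 0) \<or> (\<forall>x\<in>half_plane. u0 x = \<alpha> * (x$1)\<^sup>2)) \<and>
      (\<not> (\<forall>x\<in>half_plane. u0 x = 0) \<longrightarrow> (scaled_volume \<Omega> u x0 \<longlongrightarrow> 2/3) (at_right 0)) \<and>
      ((\<forall>x\<in>half_plane. u0 x = 0) \<longrightarrow>
         (scaled_volume \<Omega> u x0 \<longlongrightarrow> 0) (at_right 0) \<or>
         (scaled_volume \<Omega> u x0 \<longlongrightarrow> 2/3) (at_right 0))"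
proof -
  \<comment> \<open>Every solution falls under the second alternative, with the coefficient
    \<open>l / 2\<close> for \<open>l = sqrt (x0$2)\<close>, which depends on \<open>x0\<close>
    alone. The implication for vanishing \<open>u0\<close> is met through its value
    \<open>2/3\<close>.\<close>
  have key: "(\<forall>x\<in>half_plane. u0 x = sqrt (x0$2) / 2 * (x$1)\<^sup>2) \<and>
      (scaled_volume \<Omega> u x0 \<longlongrightarrow> 2/3) (at_right 0)"
    if sol: "subsonic_weak_solution g rho0 \<beta> p \<Omega> u" and gb: "gradient_bound \<Omega> u"
      and x0_frontier: "x0 \<in> \<Omega> \<inter> frontier (pos_set \<Omega> u)" and blowup: "blowup_limit \<Omega> u x0 u0"
    for \<Omega> :: "(real^2) set" and u u0 :: "real^2 \<Rightarrow> real"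
  proof -
    have sol': "subsonic_variational_solution g rho0 p \<Omega> u"
      using sol by (simp add: subsonic_weak_solution_def)
    note sol'' = sol'[unfolded subsonic_variational_solution_def flow_domain_def]
    have x0: "x0 \<in> \<Omega>" "x0$1 = 0" and x0_closure: "x0 \<in> closure (pos_set \<Omega> u)"
      using x0_frontier assms(2) by (auto simp: frontier_def)
    have op: "openin (top_of_set {x. 0 \<le> x$1}) \<Omega>" using sol'' by blast
    then have half: "0 \<le> x$1" if "x \<in> \<Omega>" for x using that openin_imp_subset by blast
    have nonneg: "0 \<le> u x" if "x \<in> \<Omega>" for x using sol'' that by blast
    have axis0: "u x = 0" if "x \<in> \<Omega>" "x$1 = 0" for x using sol'' that by blast
    have cont: "continuous_on \<Omega> u" and C2: "C2_on (pos_set \<Omega> u) u" using sol'' by blast+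
    obtain l where lim1: "((\<lambda>x. 1 / x$1 * grad u x $ 1) \<longlongrightarrow> l) (at x0 within pos_set \<Omega> u)"
      and lim2: "((\<lambda>x. 1 / x$1 * grad u x $ 2) \<longlongrightarrow> 0) (at x0 within pos_set \<Omega> u)"
      using sol'' x0 by meson
    obtain \<delta> where \<delta>: "0 < \<delta>" "axis_box x0 \<delta> \<subseteq> \<Omega>" using axis_box_exists[OF op x0] .
    \<comment> \<open>A closure point outside the set is an accumulation point, so limits at
      \<open>x0\<close> are unique.\<close>
    have "x0 \<notin> pos_set \<Omega> u" using axis0[OF x0] by (simp add: pos_set_def)
    with x0_closure have "at x0 within pos_set \<Omega> u \<noteq> bot"
      by (simp add: closure_def trivial_limit_within)
    then have "l\<^sup>2 = x0$2" by (intro axis_gradient_limit_square[OF op x0 gb _ lim1 lim2])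
    moreover have "0 \<le> l"
      by (rule axis_gradient_limit_nonneg[OF cont C2 axis0 \<delta>(2,1) x0(2) half lim1 lim2 x0_closure])
    ultimately have l: "l = sqrt (x0$2)" by (metis real_sqrt_unique)
    with assms(3) have l_pos: "0 < l" by simp
    have lim: "((\<lambda>r. blowup u x0 r z) \<longlongrightarrow> l / 2 * (z$1)\<^sup>2) (at_right 0)" if "z \<in> half_plane" for z
      using blowup_tendsto_quadratic[OF cont C2 nonneg axis0 \<delta>(2,1) x0(2) half lim1 lim2 l_pos x0_closure that] .
    have "u0 z = l / 2 * (z$1)\<^sup>2" if z: "z \<in> half_plane" for z
    proof -
      \<comment> \<open>A singleton is compact, so locally uniform convergence yields the pointwise
        limit, to be compared with \<open>lim\<close>.\<close>
      have "uniform_limit {z} (blowup u x0) u0 (at_right 0)"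
        using blowup z unfolding blowup_limit_def by (metis compact_sing empty_subsetI insert_subset)
      then have "((\<lambda>r. blowup u x0 r z) \<longlongrightarrow> u0 z) (at_right 0)"
        by (rule tendsto_uniform_limitI) simp
      then show ?thesis using lim[OF z] tendsto_unique[of "at_right (0::real)"] by force
    qed
    moreover have "(scaled_volume \<Omega> u x0 \<longlongrightarrow> 2/3) (at_right 0)"
    proof (rule scaled_volume_tendsto[OF x0(2)])
      show "pos_set \<Omega> u \<in> sets borel" using open_pos_set[OF op cont axis0] by simp
      fix z :: "real^2" assume z: "z \<in> half_plane"
      \<comment> \<open>Strict positivity of the limit at \<open>z\<close> makes \<open>u\<close>
        positive at the rescaled points for small \<open>r\<close>.\<close>
      then have "0 < l / 2 * (z$1)\<^sup>2" using l_pos by (simp add: half_plane_def)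
      with lim[OF z] have "\<forall>\<^sub>F r in at_right 0. 0 < blowup u x0 r z" by (rule order_tendstoD)
      with eventually_in_axis_box[OF \<delta>(1) z x0(2)]
      show "\<forall>\<^sub>F r in at_right 0. x0 + r *\<^sub>R z \<in> pos_set \<Omega> u"
        by eventually_elim (use \<delta>(2) in \<open>auto simp: pos_set_def blowup_def zero_less_divide_iff\<close>)
    qed
    ultimately show ?thesis by (simp add: l)
  qed
  have "0 < sqrt (x0$2) / 2" using assms(3) by simp
  then show ?thesis
    by (intro exI[of _ "sqrt (x0$2) / 2"]) (use key in blast)
qed

end
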